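(* For all fixed integers $q\ge 0$, $p\ge 1$ and $m\ge\max(1,\lceil q/2\rceil)$, as $n\to\infty$, $$\sum_{k=1}^{n} k^q (\log k)^p = n^{q+1} \sum_{r=0}^p \frac{(-1)^r p!}{(p-r)!}\, \frac{(\log n)^{p-r}}{(q+1)^{r+1}} +\frac12 n^q (\log n)^p + \sum_{k=1}^{\lceil q/2 \rceil} \Big( \sum_{r=0}^p c_{p,q,k,r} (\log n)^{p-r} \Big) n^{q-2k+1} + \mathrm{const} + \sum_{k= \lceil q/2 \rceil +1}^m \frac{\sum_{r=1}^p d_{p,q,k,r} (\log n)^{p-r}}{n^{2k-q-1}} +O\Big(\frac{(\log n)^{p-1}}{n^{2m-q}}\Big),$$ where $$c_{p,q,k,r} := \frac{B_{2k}}{(2k)!}\,\frac{q!}{(q-2k+1)!}\,\frac{p!}{(p-r)!}\, S_{r,q-2k+2,q},$$ $$d_{p,q,k,r} := \frac{B_{2k}\, (-1)^{r+q+1}}{(2k)(2k-1)\cdots(2k-q-1)}\,\frac{p!\,q!}{(p-r)!} \sum_{j=0}^q (-1)^j S_{j,1,q}\, S_{r-j-1,1,2k-q-2},$$ $$\mathrm{const} = (-1)^p \zeta^{(p)} (-q) +\frac{B_{q+1}}{q+1}\, p!\, S_{p,1,q},$$ and where, for odd $q$, the term with $k=\lceil q/2\rceil$ and $r=p$ of the sum $\sum_{k=1}^{\lceil q/2\rceil}$ (which is independent of $n$ and equals $\frac{B_{q+1}}{q+1}p!\,S_{p,1,q}$) is omitted, as it is already counted in $\mathrm{const}$.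
   Context: $B_j$ are the Bernoulli numbers; $\zeta^{(p)}$ is the $p$-th derivative of the (analytically continued) Riemann zeta function. $S_{r,s,t}:=\sum_{s\le i_1<\dots<i_r\le t}\frac{1}{i_1\cdots i_r}$ (sum over integers), which is $0$ for $r\ge 1$ and $t<r+s-1$; $S_{0,s,t}:=1$ if $t\ge s-1$, and $S_{r,s,t}:=0$ if $r<0$. Empty sums are $0$. *)

theory Defs
  imports "HOL-Complex_Analysis.Complex_Analysis" "HOL-Library.Landau_Symbols"
begin

text \<open>
  Generating function \<open>x / (e\<^sup>x - 1)\<close>, that is, the convention \<open>B\<^sub>1 = -1/2\<close>.
\<close>
definition bernoulli :: "nat \<Rightarrow> real" where
  "bernoulli j = fact j * fps_nth (fps_X / (fps_exp 1 - 1)) j"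

text \<open>
  The analytic continuation of the Dirichlet series to the punctured plane; it is unique there
  by the identity theorem. The value at the pole is unspecified.
\<close>
definition zeta :: "complex \<Rightarrow> complex" where
  "zeta = (SOME f. f holomorphic_on (- {1}) \<and>
             (\<forall>s. Re s > 1 \<longrightarrow> (\<lambda>n. 1 / of_nat (Suc n) powr s) sums f s))"

text \<open>
  The tuples \<open>s \<le> i\<^sub>1 < \<dots> < i\<^sub>r \<le> t\<close> are encoded as the \<open>r\<close>-element subsets of \<open>{s..t}\<close>. There are
  none if \<open>r \<ge> 1\<close> and \<open>t < r + s - 1\<close>. For \<open>r = 0\<close> the only one is the empty set, which
  contributes the empty product 1 (also for \<open>t < s - 1\<close>, which does not occur).
\<close>
definition S :: "int \<Rightarrow> int \<Rightarrow> int \<Rightarrow> real" where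
  "S r s t = (if r < 0 then 0
              else \<Sum>I | I \<subseteq> {s..t} \<and> card I = nat r. \<Prod>i\<in>I. 1 / real_of_int i)"

definition half_up :: "nat \<Rightarrow> nat" where
  "half_up q = nat \<lceil>real q / 2\<rceil>"

text \<open>
  Only meaningful for \<open>1 \<le> k \<le> \<lceil>q / 2\<rceil>\<close> and \<open>r \<le> p\<close>, where the subtractions on natural numbers do
  not truncate. Note that \<open>q - 2 * k + 1\<close> would truncate for odd \<open>q\<close> and \<open>k = \<lceil>q / 2\<rceil>\<close>.
\<close>
definition c_coeff :: "nat \<Rightarrow> nat \<Rightarrow> nat \<Rightarrow> nat \<Rightarrow> real" where
  "c_coeff p q k r =
     bernoulli (2 * k) / fact (2 * k) * (fact q / fact (q + 1 - 2 * k)) * (fact p / fact (p - r))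
       * S r (int q - 2 * int k + 2) q"

text \<open>
  Only meaningful for \<open>k > \<lceil>q / 2\<rceil>\<close> and \<open>r \<le> p\<close>; the factors of the denominator are then positive.
\<close>
definition d_coeff :: "nat \<Rightarrow> nat \<Rightarrow> nat \<Rightarrow> nat \<Rightarrow> real" where
  "d_coeff p q k r =
     bernoulli (2 * k) * (- 1) ^ (r + q + 1) / (\<Prod>i = 0..q + 1. 2 * real k - real i)
       * (fact p * fact q / fact (p - r))
       * (\<Sum>j = 0..q. (- 1) ^ j * S j 1 q * S (int r - int j - 1) 1 (2 * int k - int q - 2))"

definition const_term :: "nat \<Rightarrow> nat \<Rightarrow> complex" where
  "const_term p q =
     (- 1) ^ p * (deriv ^^ p) zeta (- of_nat q)
       + of_real (bernoulli (q + 1) / real (q + 1) * fact p * S p 1 q)"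

end

theory Submission
  imports Defs
begin

text \<open>
  The expansion is the \<open>p\<close>-th derivative, at the exponent \<open>u = q\<close>, of the Euler-Maclaurin expansion
  \<open>\<Sum>k\<le>n. k\<^sup>u \<sim> \<zeta>(-u) + n\<^sup>u\<^sup>+\<^sup>1/(u+1) + n\<^sup>u/2 + \<Sum>k. B\<^bsub>2k\<^esub>/(2k)! u(u-1)\<dots>(u-2k+2) n\<^bsup>u-2k+1\<^esup>\<close>,
  because \<open>d/du\<close> multiplies \<open>k\<^sup>u\<close> by \<open>log k\<close>. Two things have to be justified: that the expansion
  holds with constant \<open>\<zeta>(-u)\<close> for complex \<open>u\<close>, and that it may be differentiated in \<open>u\<close>.

  No integral remainder is needed. Let \<open>F\<^sub>j(u, x)\<close> be the \<open>j\<close>-th \<open>x\<close>-derivative of \<open>x\<^sup>u\<^sup>+\<^sup>1/(u+1)\<close> and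
  \<open>G(u, x) = \<Sum>j\<le>J. B\<^sub>j/j! F\<^sub>j(u, x)\<close>. Taylor's theorem for each \<open>F\<^sub>j\<close> on \<open>[n, n+1]\<close>, together with the
  recurrence for the Bernoulli numbers, gives \<open>G(u, n+1) - G(u, n) = n\<^sup>u + O(n\<^bsup>Re u - J - 1\<^esup>)\<close>
  (\<open>em_error_bound\<close>), with a constant that is locally bounded in \<open>u\<close>. So the holomorphic functions
  \<open>(\<Sum>k<n. k\<^sup>u) - G(u, n)\<close> converge locally uniformly for \<open>u \<noteq> -1\<close>, \<open>Re u < J - 1\<close>, at a rate
  \<open>O(n\<^bsup>Re u - J + 1\<^esup>)\<close> (\<open>em_limit_remainder_bound\<close>). The limit does not depend on \<open>J\<close>, and for
  \<open>Re u < -1\<close> it is the Dirichlet series, because then \<open>G(u, n)\<close> tends to 0. Hence these limits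
  piece together to the analytic continuation of the zeta function (\<open>zeta_eq_em_limit\<close>), which
  proves both its existence and the expansion.

  The rate is uniform on a disc around \<open>q\<close>, so Cauchy's inequality transfers it to the \<open>p\<close>-th
  \<open>u\<close>-derivative (\<open>remainder_higher_deriv_bound\<close>). Taking \<open>J = 2m + 4\<close> makes this remainder so small
  that logarithms are irrelevant for it; the error in the theorem then comes from the two surplus
  terms \<open>k = m+1\<close> and \<open>k = m+2\<close>.

  It remains to find the \<open>p\<close>-th derivatives of the single terms. They are read off from the power
  series in \<open>h = u - q\<close>: the coefficient polynomial \<open>u(u-1)\<dots>(u-2k+2)\<close> is a product of linear factors,
  so its coefficients are elementary symmetric functions of reciprocals of integers, that is, the
  sums \<open>S\<close>. If \<open>2k - 1 > q\<close>, one factor vanishes at \<open>u = q\<close>. This is why the \<open>d\<close> coefficients start at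
  \<open>r = 1\<close> and look different from the \<open>c\<close> coefficients, and why the power of the logarithm in the error
  is \<open>p - 1\<close> only.
\<close>

section \<open>Bernoulli numbers\<close>

lemma bernoulli_over_fact: "bernoulli j / fact j = fps_nth (fps_X / (fps_exp 1 - 1)) j"
  by (simp add: bernoulli_def)

text \<open>
  The constant term of \<open>e\<^sup>x - 1\<close> is 0, so division by it is truncating in general; it is exact here
  because \<open>e\<^sup>x - 1\<close> has a zero of order exactly 1 and thus divides \<open>x\<close>.
\<close>
lemma bernoulli_fps_times_exp_minus_one:
  "fps_X / (fps_exp 1 - 1) * (fps_exp 1 - 1) = (fps_X :: real fps)"
proof -
  have sub: "subdegree (fps_exp 1 - 1 :: real fps) = 1"
    by (rule subdegreeI) auto
  have nz: "(fps_exp 1 - 1 :: real fps) \<noteq> 0"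
    using sub by force
  have "(fps_exp 1 - 1 :: real fps) dvd fps_X"
    by (subst fps_dvd_iff) (use nz sub in auto)
  then show ?thesis by simp
qed

text \<open>
  The coefficients of \<open>Q(x) e\<^sup>x = Q(x) + x\<close> for \<open>Q(x) = x / (e\<^sup>x - 1)\<close>. In this form the recurrence is
  exactly what collapses the Taylor expansions in \<open>em_error_bound\<close>.
\<close>
lemma bernoulli_exp_convolution:
  "(\<Sum>j\<le>l. bernoulli j / fact j * (1 / fact (l - j))) = bernoulli l / fact l + (if l = 1 then 1 else 0)"
proof -
  define Q :: "real fps" where "Q = fps_X / (fps_exp 1 - 1)"
  have "Q * fps_exp 1 = Q + fps_X"
    using bernoulli_fps_times_exp_minus_one by (simp add: Q_def algebra_simps)
  then have "fps_nth (Q * fps_exp 1) l = fps_nth Q l + (if l = 1 then 1 else 0)"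
    by simp
  then show ?thesis
    by (simp add: fps_mult_nth bernoulli_over_fact Q_def atMost_atLeast0)
qed

text \<open>
  \<open>Q(-x) = Q(x) e\<^sup>x = Q(x) + x\<close>, so that \<open>Q(x) + x/2\<close> is even.
\<close>
lemma bernoulli_odd:
  assumes "odd j" "j \<noteq> 1"
  shows "bernoulli j = 0"
proof -
  define Q :: "real fps" where "Q = fps_X / (fps_exp 1 - 1)"
  define R where "R = fps_compose Q (- fps_X)"
  have QX: "Q * (fps_exp 1 - 1) = fps_X"
    using bernoulli_fps_times_exp_minus_one by (simp add: Q_def)
  have e: "fps_exp (-1) * fps_exp 1 = (1 :: real fps)"
    by (simp add: fps_exp_add_mult [symmetric])
  have compose_exp: "fps_compose (fps_exp 1) (- fps_X) = (fps_exp (-1) :: real fps)"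
    using fps_exp_compose_linear[of "1::real" "-1"] by (simp add: fps_eq_iff fps_compose_uminus')
  have "fps_compose (Q * (fps_exp 1 - 1)) (- fps_X) = R * (fps_exp (-1) - 1)"
    by (simp add: fps_compose_mult_distrib fps_compose_sub_distrib R_def compose_exp)
  then have "R * (fps_exp (-1) - 1) = - fps_X"
    by (simp add: QX)
  then have "R * (fps_exp (-1) - 1) * fps_exp 1 = - fps_X * fps_exp 1"
    by simp
  then have "R * (1 - fps_exp 1) = - fps_X * fps_exp 1"
    by (simp add: algebra_simps e e [unfolded mult.commute [of "fps_exp (-1)"]])
  also have "\<dots> = - Q * (fps_exp 1 - 1) * fps_exp 1"
    by (simp add: QX)
  finally have "R * (fps_exp 1 - 1) = (Q * fps_exp 1) * (fps_exp 1 - 1)"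
    by (simp add: algebra_simps)
  moreover have "(fps_exp 1 - 1 :: real fps) \<noteq> 0"
    using QX by auto
  ultimately have "R = Q * fps_exp 1"
    by simp
  also have "\<dots> = Q + fps_X"
    using QX by (simp add: algebra_simps)
  finally have "fps_nth R j = fps_nth Q j"
    using assms by simp
  moreover have "fps_nth R j = - fps_nth Q j"
    using assms by (simp add: R_def fps_compose_uminus')
  ultimately show ?thesis
    by (simp add: bernoulli_def Q_def)
qed

section \<open>The Euler-Maclaurin step for complex powers\<close>

text \<open>
  The factor in front of the \<open>j\<close>-th \<open>x\<close>-derivative of \<open>x\<^sup>u\<^sup>+\<^sup>1/(u+1)\<close>. For \<open>j \<ge> 1\<close> the division by \<open>u + 1\<close>
  is already carried out, which leaves a polynomial in \<open>u\<close>.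
\<close>
definition antideriv_coeff :: "nat \<Rightarrow> complex \<Rightarrow> complex" where
  "antideriv_coeff j u = (case j of 0 \<Rightarrow> 1 / (u + 1) | Suc i \<Rightarrow> \<Prod>l<i. u - of_nat l)"

definition power_deriv :: "nat \<Rightarrow> complex \<Rightarrow> complex \<Rightarrow> complex" where
  "power_deriv j u x = antideriv_coeff j u * x powr (u + 1 - of_nat j)"

lemma power_deriv_1: "power_deriv (Suc 0) u x = x powr u"
  by (simp add: power_deriv_def antideriv_coeff_def)

lemma antideriv_coeff_Suc:
  assumes "u \<noteq> -1"
  shows "antideriv_coeff (Suc j) u = (u + 1 - of_nat j) * antideriv_coeff j u"
proof (cases j)
  case 0
  have "u + 1 \<noteq> 0" using assms by (metis eq_neg_iff_add_eq_0)
  then show ?thesis using 0 by (simp add: antideriv_coeff_def)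
qed (simp add: antideriv_coeff_def)

lemma power_deriv_has_field_derivative:
  assumes "u \<noteq> -1" "x \<notin> \<real>\<^sub>\<le>\<^sub>0"
  shows "(power_deriv j u has_field_derivative power_deriv (Suc j) u x) (at x within A)"
proof -
  have e: "u + 1 - of_nat j - 1 = u + 1 - of_nat (Suc j)"
    by simp
  have "((\<lambda>x. antideriv_coeff j u * x powr (u + 1 - of_nat j)) has_field_derivative
         antideriv_coeff j u * ((u + 1 - of_nat j) * x powr (u + 1 - of_nat j - 1))) (at x within A)"
    by (intro DERIV_cmult has_field_derivative_at_within[OF has_field_derivative_powr] assms)
  then show ?thesis
    unfolding e by (simp add: power_deriv_def [abs_def] antideriv_coeff_Suc assms(1) mult_ac)
qed

lemma antideriv_coeff_holomorphic: "antideriv_coeff j holomorphic_on (- {-1})"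
proof (cases j)
  case 0
  show ?thesis
    unfolding antideriv_coeff_def 0 by (auto intro!: holomorphic_intros simp: add_eq_0_iff2)
qed (auto simp: antideriv_coeff_def [abs_def] intro!: holomorphic_intros)

lemma power_deriv_holomorphic:
  "x \<noteq> 0 \<Longrightarrow> (\<lambda>u. power_deriv j u x) holomorphic_on (- {-1})"
  unfolding power_deriv_def by (intro holomorphic_intros antideriv_coeff_holomorphic)

text \<open>
  These terms vanish in the limit, so adding or dropping them in the Euler-Maclaurin polynomial does
  not change the limit: this yields both the independence of \<open>J\<close> and the Dirichlet series.
\<close>
lemma power_deriv_tendsto_0:
  assumes "Re u + 1 < real j"
  shows "(\<lambda>n. power_deriv j u (of_nat n)) \<longlonglongrightarrow> 0"
proof -
  have "(\<lambda>n. of_nat n powr (u + 1 - of_nat j) :: complex) \<longlonglongrightarrow> 0"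
  proof (rule Lim_null_comparison)
    show "\<forall>\<^sub>F n in sequentially. norm (of_nat n powr (u + 1 - of_nat j) :: complex) \<le> real n powr (Re u + 1 - j)"
      by (rule always_eventually) (simp add: norm_powr_real_powr)
    show "(\<lambda>n. real n powr (Re u + 1 - j)) \<longlonglongrightarrow> 0"
      by (rule tendsto_neg_powr) (use assms in \<open>auto intro: filterlim_real_sequentially\<close>)
  qed
  from tendsto_mult_right_zero[OF this] show ?thesis
    unfolding power_deriv_def .
qed

definition em_poly :: "nat \<Rightarrow> complex \<Rightarrow> complex \<Rightarrow> complex" where
  "em_poly J u x = (\<Sum>j\<le>J. of_real (bernoulli j / fact j) * power_deriv j u x)"

definition em_error :: "nat \<Rightarrow> complex \<Rightarrow> nat \<Rightarrow> complex" where
  "em_error J u n = em_poly J u (of_nat (Suc n)) - em_poly J u (of_nat n) - of_nat n powr u"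

lemma em_poly_holomorphic: "x \<noteq> 0 \<Longrightarrow> (\<lambda>u. em_poly J u x) holomorphic_on (- {-1})"
  unfolding em_poly_def by (intro holomorphic_intros power_deriv_holomorphic)

text \<open>
  Taylor's theorem on \<open>[n, n+1]\<close>, up to the derivative of order \<open>J + 2\<close> of \<open>x\<^sup>u\<^sup>+\<^sup>1/(u+1)\<close> whatever \<open>j\<close> is. The
  bound on \<open>Re u\<close> makes the exponent of that derivative nonpositive, so that its modulus is
  largest at the left end point.
\<close>
lemma power_deriv_step:
  assumes u: "u \<noteq> -1" "Re u \<le> J + 1" and j: "j \<le> J" and n: "n \<ge> 1"
  shows "norm (power_deriv j u (of_nat (Suc n)) - (\<Sum>i\<le>J+1-j. power_deriv (j + i) u (of_nat n) / fact i))
         \<le> norm (antideriv_coeff (J + 2) u) * real n powr (Re u - J - 1)"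
proof -
  define A where "A = closed_segment (of_nat n :: complex) (of_nat (Suc n))"
  have A: "x \<in> \<real> \<and> real n \<le> Re x \<and> x \<notin> \<real>\<^sub>\<le>\<^sub>0" if "x \<in> A" for x
  proof -
    have "A = of_real ` closed_segment (real n) (real (Suc n))"
      unfolding A_def by (metis closed_segment_of_real of_real_of_nat_eq)
    with that obtain y where y: "x = of_real y" "y \<in> closed_segment (real n) (real (Suc n))"
      by blast
    then have "real n \<le> y"
      by (auto simp: closed_segment_eq_real_ivl)
    then show ?thesis
      using y n by (auto simp: complex_nonpos_Reals_iff)
  qed
  have "norm (power_deriv (j + 0) u (of_nat (Suc n))
              - (\<Sum>i\<le>J+1-j. power_deriv (j + i) u (of_nat n) * (of_nat (Suc n) - of_nat n) ^ i / fact i))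
        \<le> (norm (antideriv_coeff (J + 2) u) * real n powr (Re u - J - 1))
            * norm (of_nat (Suc n) - of_nat n :: complex) ^ Suc (J+1-j) / fact (J+1-j)"
  proof (rule field_Taylor[where S = A])
    show "convex A" unfolding A_def by simp
    show "(power_deriv (j + i) u has_field_derivative power_deriv (j + Suc i) u x) (at x within A)"
      if "x \<in> A" for i x
      using power_deriv_has_field_derivative[OF u(1), of x "j + i"] A[OF that] by simp
    show "of_nat n \<in> A" "of_nat (Suc n) \<in> A" unfolding A_def by auto
    show "norm (power_deriv (j + Suc (J+1-j)) u x) \<le> norm (antideriv_coeff (J + 2) u) * real n powr (Re u - J - 1)"
      if "x \<in> A" for x
    proof -
      have e: "j + Suc (J+1-j) = J + 2" using j by simp
      have "norm (x powr (u + 1 - of_nat (J + 2))) = Re x powr (Re u + 1 - (J + 2))"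
        using A[OF that] n by (subst norm_powr_real_powr) auto
      also have "\<dots> \<le> real n powr (Re u + 1 - (J + 2))"
        using A[OF that] u(2) n by (intro powr_mono2') auto
      also have "Re u + 1 - (J + 2) = Re u - J - 1" by simp
      finally show ?thesis
        unfolding e power_deriv_def norm_mult by (intro mult_left_mono) auto
    qed
  qed
  also have "\<dots> \<le> norm (antideriv_coeff (J + 2) u) * real n powr (Re u - J - 1)"
  proof -
    have "c / fact k \<le> c" if "c \<ge> 0" for c :: real and k
      using that divide_left_mono[of 1 "fact k" c] by (simp add: fact_ge_1)
    then show ?thesis by simp
  qed
  finally show ?thesis by simp
qed

text \<open>
  Expanding every \<open>F\<^sub>j(u, n+1)\<close> by Taylor's theorem and sorting by the order \<open>l\<close> of the derivative, the
  coefficient of \<open>F\<^sub>l(u, n)\<close> becomes \<open>\<Sum>j\<le>l. B\<^sub>j/(j! (l-j)!)\<close>, that is, \<open>B\<^sub>l/l!\<close> plus 1 if \<open>l = 1\<close>. The first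
  parts make up the polynomial at \<open>n\<close>, and \<open>F\<^sub>1(u, n) = n\<^sup>u\<close>.
\<close>
lemma em_error_bound:
  assumes u: "u \<noteq> -1" "Re u \<le> J + 1" and n: "n \<ge> 1"
  shows "norm (em_error J u n)
         \<le> (\<Sum>j\<le>J. \<bar>bernoulli j / fact j\<bar>) * norm (antideriv_coeff (J + 2) u) * real n powr (Re u - J - 1)"
proof -
  define b where "b j = (of_real (bernoulli j / fact j) :: complex)" for j
  define F where "F j = power_deriv j u (of_nat n)" for j
  define M where "M = norm (antideriv_coeff (J + 2) u) * real n powr (Re u - J - 1)"
  have conv: "(\<Sum>j\<le>l. b j / fact (l - j)) = b l + (if l = 1 then 1 else 0)" for l
  proof -
    have "(\<Sum>j\<le>l. b j / fact (l - j)) = of_real (\<Sum>j\<le>l. bernoulli j / fact j * (1 / fact (l - j)))"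
      by (simp add: b_def)
    then show ?thesis
      unfolding bernoulli_exp_convolution by (simp add: b_def)
  qed
  have "(\<Sum>j\<le>J+1. \<Sum>i\<le>J+1-j. b j * F (j + i) / fact i) = (\<Sum>l\<le>J+1. \<Sum>j\<le>l. b j * F (j + (l - j)) / fact (l - j))"
  proof -
    have "Sigma {..J+1} (\<lambda>j. {..J+1-j}) = {(j, i). j + i \<le> J + 1}"
      by auto
    moreover have "(\<Sum>j\<le>J+1. \<Sum>i\<le>J+1-j. b j * F (j + i) / fact i) =
        (\<Sum>(j, i)\<in>Sigma {..J+1} (\<lambda>j. {..J+1-j}). b j * F (j + i) / fact i)"
      by (rule sum.Sigma) auto
    ultimately show ?thesis
      by (simp only: sum.triangle_reindex_eq)
  qed
  also have "\<dots> = (\<Sum>l\<le>J+1. F l * (\<Sum>j\<le>l. b j / fact (l - j)))"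
    by (intro sum.cong) (auto simp: sum_distrib_left mult_ac)
  also have "\<dots> = (\<Sum>l\<le>J+1. b l * F l) + (\<Sum>l\<le>J+1. if l = 1 then F l else 0)"
    unfolding conv by (subst sum.distrib [symmetric], intro sum.cong) (auto simp: algebra_simps)
  also have "(\<Sum>l\<le>J+1. if l = 1 then F l else 0) = of_nat n powr u"
    by (simp add: F_def power_deriv_1)
  \<comment> \<open>The index \<open>j = J + 1\<close>, present only to make the double sum triangular, contributes the same on both sides.\<close>
  finally have main: "(\<Sum>j\<le>J. \<Sum>i\<le>J+1-j. b j * F (j + i) / fact i) = (\<Sum>l\<le>J. b l * F l) + of_nat n powr u"
    by simp
  have "em_error J u n = (\<Sum>j\<le>J. b j * (power_deriv j u (of_nat (Suc n)) - (\<Sum>i\<le>J+1-j. F (j + i) / fact i)))"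
    using main unfolding em_error_def em_poly_def right_diff_distrib sum_subtractf sum_distrib_left
    by (simp add: b_def F_def)
  also have "norm \<dots> \<le> (\<Sum>j\<le>J. norm (b j) * M)"
  proof (intro sum_norm_le)
    fix j assume "j \<in> {..J}"
    then show "norm (b j * (power_deriv j u (of_nat (Suc n)) - (\<Sum>i\<le>J+1-j. F (j + i) / fact i))) \<le> norm (b j) * M"
      unfolding norm_mult M_def F_def using assms by (intro mult_left_mono power_deriv_step) auto
  qed
  also have "\<dots> = (\<Sum>j\<le>J. \<bar>bernoulli j / fact j\<bar>) * M"
    unfolding b_def norm_of_real sum_distrib_right ..
  finally show ?thesis
    by (simp add: M_def mult.assoc)
qed

section \<open>Convergence, with a locally uniform rate\<close>

definition em_partial :: "nat \<Rightarrow> complex \<Rightarrow> nat \<Rightarrow> complex" where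
  "em_partial J u n = (\<Sum>k = 1..<n. of_nat k powr u) - em_poly J u (of_nat n)"

definition em_limit :: "nat \<Rightarrow> complex \<Rightarrow> complex" where
  "em_limit J u = em_partial J u 1 - (\<Sum>i. em_error J u (Suc i))"

lemma em_partial_Suc:
  "n \<ge> 1 \<Longrightarrow> em_partial J u (Suc n) = em_partial J u n - em_error J u n"
  by (simp add: em_partial_def em_error_def del: of_nat_Suc)

lemma em_partial_add:
  "n \<ge> 1 \<Longrightarrow> em_partial J u (n + m) = em_partial J u n - (\<Sum>i<m. em_error J u (n + i))"
  by (induction m) (simp_all add: em_partial_Suc)

lemma em_partial_holomorphic:
  "n \<ge> 1 \<Longrightarrow> (\<lambda>u. em_partial J u n) holomorphic_on (- {-1})"
  unfolding em_partial_def by (intro holomorphic_intros em_poly_holomorphic) auto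

text \<open>
  The factor \<open>1/n\<^sup>2\<close> is split off for summation over \<open>n\<close>. Summing it alone loses one power of \<open>n\<close>
  against the true rate, which is harmless because \<open>J\<close> can be taken as large as desired.
\<close>
lemma em_error_uniform_bound:
  assumes K: "compact K" "\<And>u. u \<in> K \<Longrightarrow> u \<noteq> -1 \<and> Re u \<le> real J - 1"
  obtains C where "C \<ge> 0"
    "\<And>u n. u \<in> K \<Longrightarrow> n \<ge> 1 \<Longrightarrow> norm (em_error J u n) \<le> C * real n powr (Re u - real J + 1) * (1 / real n ^ 2)"
proof -
  have "continuous_on K (antideriv_coeff (J + 2))"
    by (rule holomorphic_on_imp_continuous_on, rule holomorphic_on_subset, rule antideriv_coeff_holomorphic)
       (use K in auto)
  then have "bounded (antideriv_coeff (J + 2) ` K)"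
    using K(1) compact_continuous_image compact_imp_bounded by blast
  then obtain B where B: "B > 0" "\<And>u. u \<in> K \<Longrightarrow> norm (antideriv_coeff (J + 2) u) \<le> B"
    unfolding bounded_pos by auto
  define C where "C = (\<Sum>j\<le>J. \<bar>bernoulli j / fact j\<bar>) * B"
  show thesis
  proof (rule that[of C])
    show "C \<ge> 0" unfolding C_def using B by (intro mult_nonneg_nonneg sum_nonneg) auto
    fix u and n :: nat assume u: "u \<in> K" and n: "n \<ge> 1"
    have "norm (em_error J u n) \<le> (\<Sum>j\<le>J. \<bar>bernoulli j / fact j\<bar>) * norm (antideriv_coeff (J + 2) u) * real n powr (Re u - J - 1)"
      using K(2)[OF u] n by (intro em_error_bound) auto
    also have "\<dots> \<le> C * real n powr (Re u - J - 1)"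
      unfolding C_def using B u by (intro mult_right_mono mult_left_mono sum_nonneg) auto
    also have "Re u - J - 1 = (Re u - J + 1) - real 2" by simp
    also have "real n powr \<dots> = real n powr (Re u - real J + 1) * (1 / real n ^ 2)"
      using n by (subst powr_diff, subst powr_realpow) auto
    finally show "norm (em_error J u n) \<le> C * real n powr (Re u - real J + 1) * (1 / real n ^ 2)"
      by (simp add: mult.assoc)
  qed
qed

lemma summable_inverse_squares_shift: "summable (\<lambda>i. 1 / real (Suc i) ^ 2)"
  using inverse_squares_sums by (simp add: sums_iff add.commute)

lemma em_partial_uniform_limit:
  assumes K: "compact K" "\<And>u. u \<in> K \<Longrightarrow> u \<noteq> -1 \<and> Re u \<le> real J - 1"
  shows "uniform_limit K (\<lambda>n u. em_partial J u (Suc n)) (em_limit J) sequentially"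
proof -
  obtain C where C: "C \<ge> 0"
    "\<And>u n. u \<in> K \<Longrightarrow> n \<ge> 1 \<Longrightarrow> norm (em_error J u n) \<le> C * real n powr (Re u - real J + 1) * (1 / real n ^ 2)"
    using em_error_uniform_bound[OF K] by blast
  have "uniform_limit K (\<lambda>n u. \<Sum>i<n. em_error J u (Suc i)) (\<lambda>u. \<Sum>i. em_error J u (Suc i)) sequentially"
  proof (rule Weierstrass_m_test)
    fix i u assume u: "u \<in> K"
    have "norm (em_error J u (Suc i)) \<le> C * real (Suc i) powr (Re u - real J + 1) * (1 / real (Suc i) ^ 2)"
      using C(2)[OF u, of "Suc i"] by simp
    also have "\<dots> \<le> C * 1 * (1 / real (Suc i) ^ 2)"
    proof (intro mult_right_mono mult_left_mono C)
      have "real (Suc i) powr (Re u - real J + 1) \<le> real (Suc i) powr 0"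
        using K(2)[OF u] by (intro powr_mono) auto
      then show "real (Suc i) powr (Re u - real J + 1) \<le> 1" by simp
    qed auto
    finally show "norm (em_error J u (Suc i)) \<le> C * (1 / real (Suc i) ^ 2)" by simp
  qed (intro summable_mult summable_inverse_squares_shift)
  then have "uniform_limit K (\<lambda>n u. em_partial J u 1 - (\<Sum>i<n. em_error J u (Suc i)))
      (\<lambda>u. em_partial J u 1 - (\<Sum>i. em_error J u (Suc i))) sequentially"
    by (intro uniform_limit_intros)
  moreover have "em_partial J u 1 - (\<Sum>i<n. em_error J u (Suc i)) = em_partial J u (Suc n)" for n u
    using em_partial_add[of 1 J u n] by simp
  ultimately show ?thesis
    by (simp add: em_limit_def [abs_def])
qed

lemma em_partial_tendsto:
  assumes "u \<noteq> -1" "Re u \<le> real J - 1"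
  shows "em_partial J u \<longlonglongrightarrow> em_limit J u"
proof -
  have "uniform_limit {u} (\<lambda>n u. em_partial J u (Suc n)) (em_limit J) sequentially"
    using assms by (intro em_partial_uniform_limit) auto
  then have "(\<lambda>n. em_partial J u (Suc n)) \<longlonglongrightarrow> em_limit J u"
    by (rule tendsto_uniform_limitI) simp
  then show ?thesis by (rule LIMSEQ_imp_Suc)
qed

lemma em_limit_holomorphic: "em_limit J holomorphic_on ({u. Re u < real J - 1} - {-1})"
proof -
  define D where "D = {u. Re u < real J - 1} - {-1}"
  have "open D"
    unfolding D_def by (intro open_Diff open_halfspace_Re_lt closed_singleton)
  have "em_limit J holomorphic_on D"
  proof (rule holomorphic_uniform_sequence[OF \<open>open D\<close>])
    show "(\<lambda>u. em_partial J u (Suc n)) holomorphic_on D" for n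
      by (rule holomorphic_on_subset, rule em_partial_holomorphic) (auto simp: D_def)
    fix x assume "x \<in> D"
    then obtain d where d: "d > 0" "cball x d \<subseteq> D"
      using \<open>open D\<close> open_contains_cball by blast
    moreover have "uniform_limit (cball x d) (\<lambda>n u. em_partial J u (Suc n)) (em_limit J) sequentially"
      using d by (intro em_partial_uniform_limit) (auto simp: D_def)
    ultimately show "\<exists>d. 0 < d \<and> cball x d \<subseteq> D \<and>
        uniform_limit (cball x d) (\<lambda>n u. em_partial J u (Suc n)) (em_limit J) sequentially"
      by blast
  qed
  then show ?thesis unfolding D_def .
qed

text \<open>
  The tail of the telescoping series: on its terms the factor \<open>n\<^bsup>Re u - J + 1\<^esup>\<close> decreases and can be taken
  out, and the sum of the reciprocal squares is bounded by a constant.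
\<close>
lemma em_limit_remainder_bound:
  assumes K: "compact K" "\<And>u. u \<in> K \<Longrightarrow> u \<noteq> -1 \<and> Re u \<le> real J - 1"
  obtains C where "C \<ge> 0" "\<And>u n. u \<in> K \<Longrightarrow> n \<ge> 1 \<Longrightarrow>
    norm (em_partial J u n - em_limit J u) \<le> C * real n powr (Re u - real J + 1)"
proof -
  obtain C where C: "C \<ge> 0"
    "\<And>u n. u \<in> K \<Longrightarrow> n \<ge> 1 \<Longrightarrow> norm (em_error J u n) \<le> C * real n powr (Re u - real J + 1) * (1 / real n ^ 2)"
    using em_error_uniform_bound[OF K] by blast
  define c where "c = (\<Sum>i. 1 / real (Suc i) ^ 2)"
  have "c \<ge> 0"
    unfolding c_def by (intro suminf_nonneg summable_inverse_squares_shift) auto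
  show thesis
  proof (rule that[of "C * c"])
    show "C * c \<ge> 0" using C(1) \<open>c \<ge> 0\<close> by simp
    fix u and n :: nat assume u: "u \<in> K" and n: "n \<ge> 1"
    let ?p = "real n powr (Re u - real J + 1)"
    have part: "norm (em_partial J u n - em_partial J u (n + m)) \<le> C * c * ?p" for m
    proof -
      have "norm (em_partial J u n - em_partial J u (n + m)) \<le> (\<Sum>i<m. norm (em_error J u (n + i)))"
        using n by (simp add: em_partial_add norm_sum)
      also have "\<dots> \<le> (\<Sum>i<m. C * ?p * (1 / real (Suc i) ^ 2))"
      proof (intro sum_mono)
        fix i
        have "norm (em_error J u (n + i)) \<le> C * real (n + i) powr (Re u - real J + 1) * (1 / real (n + i) ^ 2)"
          using n by (intro C(2)[OF u]) simp
        also have "\<dots> \<le> C * ?p * (1 / real (Suc i) ^ 2)"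
        proof (intro mult_mono)
          show "real (n + i) powr (Re u - real J + 1) \<le> ?p"
            using n K(2)[OF u] by (intro powr_mono2') auto
          show "1 / real (n + i) ^ 2 \<le> 1 / real (Suc i) ^ 2"
            using n by (intro divide_left_mono power_mono mult_pos_pos) auto
        qed (use C in auto)
        finally show "norm (em_error J u (n + i)) \<le> C * ?p * (1 / real (Suc i) ^ 2)" .
      qed
      also have "\<dots> = C * ?p * (\<Sum>i<m. 1 / real (Suc i) ^ 2)"
        by (simp add: sum_distrib_left)
      also have "\<dots> \<le> C * ?p * c"
        unfolding c_def using C(1)
        by (intro mult_left_mono sum_le_suminf summable_inverse_squares_shift) auto
      finally show ?thesis by (simp add: mult_ac)
    qed
    have "(\<lambda>m. em_partial J u (m + n)) \<longlonglongrightarrow> em_limit J u"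
      using K(2)[OF u] by (intro LIMSEQ_ignore_initial_segment em_partial_tendsto) auto
    then have "(\<lambda>m. norm (em_partial J u n - em_partial J u (n + m))) \<longlonglongrightarrow> norm (em_partial J u n - em_limit J u)"
      by (intro tendsto_intros) (simp add: add.commute)
    then show "norm (em_partial J u n - em_limit J u) \<le> C * c * ?p"
      by (rule LIMSEQ_le_const2) (use part in blast)
  qed
qed

section \<open>Analytic continuation of the zeta function\<close>

lemma em_limit_eq:
  assumes "u \<noteq> -1" "Re u \<le> real J - 1" "Re u \<le> real J' - 1"
  shows "em_limit J u = em_limit J' u"
proof -
  have *: "em_limit J u = em_limit J' u" if u: "Re u \<le> real J - 1" and "J \<le> J'" for J J'
  proof -
    have "em_partial J u n - em_partial J' u n
         = (\<Sum>j\<in>{J<..J'}. of_real (bernoulli j / fact j) * power_deriv j u (of_nat n))" for n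
    proof -
      have "{..J'} = {..J} \<union> {J<..J'}" using that by auto
      then have "em_poly J' u (of_nat n) = em_poly J u (of_nat n) +
          (\<Sum>j\<in>{J<..J'}. of_real (bernoulli j / fact j) * power_deriv j u (of_nat n))"
        unfolding em_poly_def by (simp add: sum.union_disjoint disjoint_iff)
      then show ?thesis by (simp add: em_partial_def)
    qed
    moreover have "(\<lambda>n. \<Sum>j\<in>{J<..J'}. of_real (bernoulli j / fact j) * power_deriv j u (of_nat n)) \<longlonglongrightarrow> 0"
      using u by (intro tendsto_null_sum tendsto_mult_right_zero power_deriv_tendsto_0) auto
    ultimately have "(\<lambda>n. em_partial J u n - em_partial J' u n) \<longlonglongrightarrow> 0"
      by simp
    moreover have "(\<lambda>n. em_partial J u n - em_partial J' u n) \<longlonglongrightarrow> em_limit J u - em_limit J' u"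
      using assms(1) that by (intro tendsto_diff em_partial_tendsto) auto
    ultimately have "em_limit J u - em_limit J' u = 0"
      using LIMSEQ_unique by blast
    then show ?thesis by simp
  qed
  show ?thesis
    using nat_le_linear[of J J'] *[OF assms(2)] *[OF assms(3), symmetric] by blast
qed

text \<open>
  By \<open>em_limit_eq\<close>, any \<open>J\<close> that is large compared with \<open>-s\<close> gives the same value. The choice made here
  varies with \<open>s\<close>, but locally it may be replaced by a fixed one (\<open>zeta_cont_eq\<close>).
\<close>
definition zeta_cont :: "complex \<Rightarrow> complex" where
  "zeta_cont s = em_limit (nat \<lceil>norm s\<rceil> + 2) (- s)"

lemma zeta_cont_eq:
  assumes "s \<noteq> 1" "Re s \<ge> 1 - real J"
  shows "zeta_cont s = em_limit J (- s)"
  unfolding zeta_cont_def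
proof (rule em_limit_eq)
  have "- Re s \<le> norm s" using abs_Re_le_cmod[of s] by linarith
  then show "Re (- s) \<le> real (nat \<lceil>norm s\<rceil> + 2) - 1"
    by (simp add: le_of_int_ceiling add_increasing2) linarith
qed (use assms in auto)

lemma zeta_cont_holomorphic: "zeta_cont holomorphic_on (- {1})"
proof -
  have "zeta_cont field_differentiable (at s)" if "s \<noteq> 1" for s
  proof -
    define J where "J = nat \<lceil>norm s\<rceil> + 2"
    define D where "D = {u. Re u < real J - 1} - {-1}"
    define D' where "D' = {s. Re s > 1 - real J} - {1 :: complex}"
    have "open D'"
      unfolding D'_def by (intro open_Diff open_halfspace_Re_gt closed_singleton)
    have "(em_limit J \<circ> uminus) holomorphic_on D'"
      by (rule holomorphic_on_compose_gen[OF _ em_limit_holomorphic])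
         (auto intro!: holomorphic_intros simp: D'_def)
    then have hol: "zeta_cont holomorphic_on D'"
      by (rule holomorphic_transform) (auto simp: zeta_cont_eq[of _ J] D'_def)
    have "- Re s \<le> norm s" using abs_Re_le_cmod[of s] by linarith
    then have "s \<in> D'"
      using that le_of_int_ceiling[of "norm s"] unfolding D'_def J_def by (simp add: of_nat_nat del: le_of_int_ceiling)
    then show ?thesis
      using hol \<open>open D'\<close> holomorphic_on_imp_differentiable_at by blast
  qed
  then show ?thesis
    by (simp add: holomorphic_on_def field_differentiable_at_within)
qed

text \<open>
  For \<open>Re s > 1\<close> even \<open>J = 0\<close> is admissible, and the only term \<open>n\<^sup>1\<^sup>-\<^sup>s/(1-s)\<close> of the Euler-Maclaurin
  polynomial tends to 0.
\<close>
lemma zeta_cont_sums: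
  assumes "Re s > 1"
  shows "(\<lambda>n. 1 / of_nat (Suc n) powr s) sums zeta_cont s"
proof -
  have s: "s \<noteq> 1" using assms by auto
  have "(\<lambda>n. em_partial 0 (- s) n + em_poly 0 (- s) (of_nat n)) \<longlonglongrightarrow> em_limit 0 (- s) + 0"
  proof (rule tendsto_add)
    show "em_partial 0 (- s) \<longlonglongrightarrow> em_limit 0 (- s)"
      using assms s by (intro em_partial_tendsto) auto
    show "(\<lambda>n. em_poly 0 (- s) (of_nat n)) \<longlonglongrightarrow> 0"
      unfolding em_poly_def using assms
      by (intro tendsto_null_sum tendsto_mult_right_zero power_deriv_tendsto_0) auto
  qed
  then have "(\<lambda>n. \<Sum>k = 1..<n. of_nat k powr (- s)) \<longlonglongrightarrow> zeta_cont s"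
    using assms s by (simp add: em_partial_def zeta_cont_eq[of s 0])
  then have "(\<lambda>n. \<Sum>k = 1..<Suc n. of_nat k powr (- s)) \<longlonglongrightarrow> zeta_cont s"
    by (rule LIMSEQ_Suc)
  moreover have "(\<Sum>k = 1..<Suc n. of_nat k powr (- s)) = (\<Sum>i<n. 1 / of_nat (Suc i) powr s)" for n
    unfolding One_nat_def sum.shift_bounds_Suc_ivl atLeast0LessThan
    by (simp add: powr_minus field_simps)
  ultimately show ?thesis
    by (simp add: sums_def)
qed

text \<open>
  The function \<open>zeta_cont\<close> witnesses that the description of \<open>zeta\<close> is satisfiable; by the identity
  theorem, nothing else satisfies it on the punctured plane.
\<close>
lemma zeta_eq_zeta_cont:
  assumes "s \<noteq> 1"
  shows "zeta s = zeta_cont s"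
proof -
  have zeta: "zeta holomorphic_on (- {1}) \<and> (\<forall>s. Re s > 1 \<longrightarrow> (\<lambda>n. 1 / of_nat (Suc n) powr s) sums zeta s)"
    unfolding zeta_def
    by (rule someI[of _ zeta_cont], intro conjI allI impI zeta_cont_holomorphic zeta_cont_sums)
  show ?thesis
  proof (rule analytic_continuation_open[of "{s. Re s > 1}" "- {1}" zeta zeta_cont])
    show "{s. Re s > 1} \<noteq> {}"
      by (auto intro: exI[of _ 2])
    show "connected (- {1 :: complex})"
      by (rule connected_punctured_universe) simp
    show "zeta s = zeta_cont s" if "s \<in> {s. Re s > 1}" for s
      using that conjunct2[OF zeta] by (intro sums_unique2[OF _ zeta_cont_sums]) auto
  qed (use assms in \<open>auto simp: open_halfspace_Re_gt conjunct1[OF zeta] zeta_cont_holomorphic\<close>)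
qed

lemma zeta_eq_em_limit:
  assumes "u \<noteq> -1" "Re u \<le> real J - 1"
  shows "zeta (- u) = em_limit J u"
proof -
  have "- u \<noteq> 1" using assms by (metis minus_minus)
  then show ?thesis
    using assms zeta_eq_zeta_cont[of "- u"] zeta_cont_eq[of "- u" J] by simp
qed

lemma zeta_holomorphic: "zeta holomorphic_on (- {1})"
  by (rule holomorphic_transform[OF zeta_cont_holomorphic]) (simp add: zeta_eq_zeta_cont)

section \<open>Power series of the terms around an integer exponent\<close>

definition antideriv_fps :: "nat \<Rightarrow> nat \<Rightarrow> complex fps" where
  "antideriv_fps q j = (case j of 0 \<Rightarrow> inverse (fps_const (of_nat q + 1) + fps_X)
      | Suc i \<Rightarrow> \<Prod>l<i. fps_const (of_nat q - of_nat l) + fps_X)"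

definition power_deriv_fps :: "nat \<Rightarrow> nat \<Rightarrow> nat \<Rightarrow> complex fps" where
  "power_deriv_fps q j n = fps_const (of_nat n powr (of_nat q + 1 - of_nat j))
      * (antideriv_fps q j * fps_exp (of_real (ln (real n))))"

lemma antideriv_coeff_has_fps_expansion:
  "(\<lambda>h. antideriv_coeff j (of_nat q + h)) has_fps_expansion antideriv_fps q j"
proof (cases j)
  case 0
  have "(of_nat q + 1 :: complex) \<noteq> 0"
    by (metis of_nat_Suc of_nat_neq_0 add.commute)
  then have "(\<lambda>h. inverse ((of_nat q + 1) + h)) has_fps_expansion antideriv_fps q j"
    unfolding antideriv_fps_def 0 nat.case by (intro fps_expansion_intros) auto
  then show ?thesis
    by (simp add: antideriv_coeff_def 0 divide_inverse add_ac)
next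
  case (Suc i)
  have "(\<lambda>h. \<Prod>l<i. (of_nat q - of_nat l) + h) has_fps_expansion antideriv_fps q j"
    unfolding antideriv_fps_def Suc nat.case by (intro fps_expansion_intros)
  then show ?thesis
    by (simp add: antideriv_coeff_def Suc algebra_simps)
qed

lemma power_deriv_has_fps_expansion:
  assumes "n \<ge> 1"
  shows "(\<lambda>h. power_deriv j (of_nat q + h) (of_nat n)) has_fps_expansion power_deriv_fps q j n"
proof -
  have "(\<lambda>h. of_nat n powr (of_nat q + 1 - of_nat j)
      * (antideriv_coeff j (of_nat q + h) * exp (of_real (ln (real n)) * h))) has_fps_expansion power_deriv_fps q j n"
    unfolding power_deriv_fps_def
    by (intro fps_expansion_intros antideriv_coeff_has_fps_expansion)
  also have "(\<lambda>h. of_nat n powr (of_nat q + 1 - of_nat j)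
      * (antideriv_coeff j (of_nat q + h) * exp (of_real (ln (real n)) * h))) =
      (\<lambda>h. power_deriv j (of_nat q + h) (of_nat n))"
  proof
    fix h :: complex
    have "Ln (of_nat n) = of_real (ln (real n))"
      using assms Ln_of_real[of "real n"] by simp
    then have "of_nat n powr (of_nat q + h + 1 - of_nat j) =
        of_nat n powr (of_nat q + 1 - of_nat j) * exp (of_real (ln (real n)) * h)"
      using assms by (simp add: powr_def exp_add [symmetric] algebra_simps)
    then show "of_nat n powr (of_nat q + 1 - of_nat j)
      * (antideriv_coeff j (of_nat q + h) * exp (of_real (ln (real n)) * h)) = power_deriv j (of_nat q + h) (of_nat n)"
      by (simp add: power_deriv_def mult_ac)
  qed
  finally show ?thesis .
qed

lemma power_deriv_fps_nth:
  "fact p * fps_nth (power_deriv_fps q j n) p =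
     of_nat n powr (of_nat q + 1 - of_nat j)
       * (\<Sum>r=0..p. fact p / fact (p - r) * fps_nth (antideriv_fps q j) r * of_real (ln (real n)) ^ (p - r))"
  unfolding power_deriv_fps_def fps_mult_left_const_nth
  by (simp add: fps_mult_nth sum_distrib_left mult_ac)

text \<open>
  The geometric series of \<open>1/(q + 1 + h)\<close>.
\<close>
lemma antideriv_fps_nth_0:
  "fps_nth (antideriv_fps q 0) r = (-1) ^ r / of_nat (q + 1) ^ (r + 1)"
proof -
  define c :: complex where "c = of_nat (q + 1)"
  have c: "c \<noteq> 0" unfolding c_def by (simp del: of_nat_add of_nat_Suc)
  define G where "G = Abs_fps (\<lambda>r. (-1) ^ r / c ^ (r + 1))"
  have "(fps_const c + fps_X) * G = 1"
  proof (rule fps_ext)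
    fix m show "fps_nth ((fps_const c + fps_X) * G) m = fps_nth 1 m"
      using c by (cases m) (simp_all add: G_def algebra_simps)
  qed
  then have "inverse (fps_const c + fps_X) = G"
    by (rule fps_inverse_unique)
  then show ?thesis
    by (simp add: antideriv_fps_def G_def c_def add_ac)
qed

lemma fps_const_prod: "(\<Prod>i\<in>A. fps_const (f i)) = fps_const (\<Prod>i\<in>A. f i :: 'a::comm_ring_1)"
  by (induction A rule: infinite_finite_induct) auto

text \<open>
  Expanding the product over all ways to choose the linear terms: the coefficients are the elementary
  symmetric functions.
\<close>
lemma fps_nth_prod_one_plus:
  fixes a :: "'i \<Rightarrow> 'a::comm_ring_1"
  assumes "finite A"
  shows "fps_nth (\<Prod>i\<in>A. 1 + fps_const (a i) * fps_X) r = (\<Sum>I | I \<subseteq> A \<and> card I = r. \<Prod>i\<in>I. a i)"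
proof -
  have "(\<Prod>i\<in>A. 1 + fps_const (a i) * fps_X) = (\<Prod>i\<in>A. fps_const (a i) * fps_X + 1)"
    by (simp add: add.commute)
  also have "\<dots> = (\<Sum>I\<in>Pow A. \<Prod>i\<in>I. fps_const (a i) * fps_X)"
    using assms by (simp add: prod_add)
  also have "\<dots> = (\<Sum>I\<in>Pow A. fps_const (\<Prod>i\<in>I. a i) * fps_X ^ card I)"
    by (simp add: prod.distrib fps_const_prod)
  also have "fps_nth \<dots> r = (\<Sum>I\<in>Pow A. if card I = r then \<Prod>i\<in>I. a i else 0)"
    by (simp add: fps_sum_nth, intro sum.cong) auto
  also have "\<dots> = (\<Sum>I | I \<in> Pow A \<and> card I = r. \<Prod>i\<in>I. a i)"
    using assms by (intro sum.inter_filter [symmetric]) auto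
  finally show ?thesis by simp
qed

lemma fps_nth_prod_S:
  "fps_nth (\<Prod>i\<in>{s..t}. 1 + fps_const (c / of_int i) * fps_X) r = c ^ r * complex_of_real (S (int r) s t)"
proof -
  have "(\<Prod>i\<in>I. c / of_int i) = c ^ r * complex_of_real (\<Prod>i\<in>I. 1 / real_of_int i)"
    if "card I = r" for I
    using that by (simp add: prod_dividef)
  then show ?thesis
    by (simp add: fps_nth_prod_one_plus S_def sum_distrib_left)
qed

lemma S_eq_0:
  assumes "int r > t - s + 1" "r > 0"
  shows "S (int r) s t = 0"
proof -
  have "card I \<noteq> r" if "I \<subseteq> {s..t}" for I
    using card_mono[OF _ that] assms by auto
  then show ?thesis
    by (auto simp: S_def intro!: sum.neutral)
qed

lemma prod_falling_eq_fact_div: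
  assumes "m \<le> q"
  shows "(\<Prod>l<m. of_nat (q - l)) = (fact q / fact (q - m) :: 'a::field_char_0)"
  using assms
proof (induction m)
  case (Suc m)
  have "q - m = Suc (q - Suc m)" using Suc.prems by simp
  then have "(fact (q - m) :: 'a) = of_nat (q - m) * fact (q - Suc m)"
    by (metis fact_Suc)
  with Suc show ?case by (simp add: field_simps)
qed simp

text \<open>
  Each of the factors \<open>q - l + h\<close> with \<open>l < m \<le> q\<close> is \<open>(q - l) (1 + h/(q - l))\<close>. The constants multiply to
  \<open>q!/(q - m)!\<close>, and \<open>i = q - l\<close> runs through \<open>q - m + 1, \<dots>, q\<close>.
\<close>
lemma antideriv_fps_nth_nonvanishing:
  assumes "m \<le> q"
  shows "fps_nth (antideriv_fps q (Suc m)) r =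
           of_real (fact q / fact (q - m) * S (int r) (int q - int m + 1) (int q))"
proof -
  have "antideriv_fps q (Suc m) = (\<Prod>l<m. fps_const (of_nat (q - l)) * (1 + fps_const (1 / of_nat (q - l)) * fps_X))"
    unfolding antideriv_fps_def nat.case
  proof (intro prod.cong refl)
    fix l assume "l \<in> {..<m}"
    then have l: "l < q" using assms by auto
    then have "(of_nat (q - l) :: complex) \<noteq> 0" by simp
    then have "fps_const (of_nat (q - l)) * (1 + fps_const (1 / of_nat (q - l)) * fps_X)
        = fps_const (of_nat (q - l) :: complex) + fps_X"
      by (simp only: distrib_left mult.assoc [symmetric] fps_const_mult) simp
    then show "fps_const (of_nat q - of_nat l) + fps_X
        = fps_const (of_nat (q - l)) * (1 + fps_const (1 / of_nat (q - l)) * fps_X :: complex fps)"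
      using l by (simp add: of_nat_diff)
  qed
  also have "\<dots> = fps_const (\<Prod>l<m. of_nat (q - l)) * (\<Prod>l<m. 1 + fps_const (1 / of_nat (q - l)) * fps_X)"
    by (simp only: prod.distrib fps_const_prod)
  also have "(\<Prod>l<m. of_nat (q - l)) = (fact q / fact (q - m) :: complex)"
    using assms by (rule prod_falling_eq_fact_div)
  also have "(\<Prod>l<m. 1 + fps_const (1 / of_nat (q - l)) * fps_X) =
      (\<Prod>i\<in>{int q - int m + 1..int q}. 1 + fps_const (1 / of_int i) * fps_X :: complex fps)"
    using assms
    by (intro prod.reindex_bij_witness[of _ "\<lambda>i. nat (int q - i)" "\<lambda>l. int q - int l"]) (auto simp: of_nat_diff)
  finally show ?thesis
    using fps_nth_prod_S[of 1 "int q - int m + 1" "int q" r] by simp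
qed

text \<open>
  Of the factors \<open>q - l + h\<close> with \<open>l \<le> q + m\<close>, the one for \<open>l = q\<close> is \<open>h\<close> itself and shifts the index by
  one. Those with \<open>l < q\<close> are covered by the previous lemma. The others are \<open>-i (1 - h/i)\<close> with
  \<open>1 \<le> i = l - q \<le> m\<close>, which accounts for \<open>(-1)\<^sup>m m!\<close> and for alternating signs in a second family of
  elementary symmetric functions. The sum over \<open>j\<close> is the Cauchy product of the two families.
\<close>
lemma antideriv_fps_nth_vanishing:
  "fps_nth (antideriv_fps q (Suc (q + 1 + m))) r =
     (if r = 0 then 0 else
       of_real ((-1) ^ (r + m + 1) * fact q * fact m *
         (\<Sum>j=0..q. (-1) ^ j * S (int j) 1 (int q) * S (int r - int j - 1) 1 (int m))))"
proof -
  define f where "f l = fps_const (of_nat q - of_nat l :: complex) + fps_X" for l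
  have split: "{..<q + 1 + m} = {..<q} \<union> {q} \<union> {q+1..<q + 1 + m}" by auto
  have "antideriv_fps q (Suc (q + 1 + m)) = prod f {..<q + 1 + m}"
    by (simp add: antideriv_fps_def f_def)
  also have "\<dots> = prod f {..<q} * f q * prod f {q+1..<q + 1 + m}"
    unfolding split by (subst prod.union_disjoint; force)+
  also have "f q = fps_X" by (simp add: f_def)
  also have "prod f {..<q} = antideriv_fps q (Suc q)"
    by (simp add: antideriv_fps_def f_def)
  also have "prod f {q+1..<q + 1 + m} = (\<Prod>i\<in>{1..int m}. fps_const (- of_int i) * (1 + fps_const (- 1 / of_int i) * fps_X))"
  proof (rule prod.reindex_bij_witness[of _ "\<lambda>i. q + nat i" "\<lambda>l. int l - int q"])
    fix l assume l: "l \<in> {q+1..<q + 1 + m}"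
    define i where "i = int l - int q"
    have i: "i \<noteq> 0" using l by (auto simp: i_def)
    have "fps_const (- of_int i) * (1 + fps_const (- 1 / of_int i) * fps_X) = fps_const (- of_int i :: complex) + fps_X"
      using i by (simp only: distrib_left mult.assoc [symmetric] fps_const_mult) simp
    then show "fps_const (- of_int (int l - int q)) * (1 + fps_const (- 1 / of_int (int l - int q)) * fps_X) = f l"
      by (simp add: f_def i_def)
  qed auto
  also have "\<dots> = fps_const (\<Prod>i\<in>{1..int m}. - of_int i) * (\<Prod>i\<in>{1..int m}. 1 + fps_const (- 1 / of_int i) * fps_X)"
    by (simp only: prod.distrib fps_const_prod)
  also have "(\<Prod>i\<in>{1..int m}. - of_int i) = ((-1) ^ m * fact m :: complex)"
  proof -
    have "(\<Prod>i\<in>{1..int m}. of_int i) = (\<Prod>i\<in>{1..m}. of_nat i :: complex)"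
      by (rule prod.reindex_bij_witness[of _ int nat]) auto
    then show ?thesis
      by (simp add: prod_uminus fact_prod)
  qed
  finally have main: "antideriv_fps q (Suc (q + 1 + m)) =
      fps_X * (fps_const ((-1) ^ m * fact m) * (antideriv_fps q (Suc q) * (\<Prod>i\<in>{1..int m}. 1 + fps_const (- 1 / of_int i) * fps_X)))"
    by (simp only: mult_ac)
  show ?thesis
  proof (cases r)
    case 0
    then show ?thesis by (simp only: main) simp
  next
    case (Suc r')
    have "fps_nth (antideriv_fps q (Suc (q + 1 + m))) r = (-1) ^ m * fact m *
        (\<Sum>j=0..r'. of_real (fact q * S (int j) 1 (int q)) * ((-1) ^ (r' - j) * of_real (S (int (r' - j)) 1 (int m))))"
      unfolding main Suc fps_X_mult_nth fps_mult_left_const_nth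
      by (simp only: fps_mult_nth fps_nth_prod_S antideriv_fps_nth_nonvanishing[OF order_refl]) simp
    also have "\<dots> = of_real ((-1) ^ m * fact m * fact q *
        (\<Sum>j=0..r'. S (int j) 1 (int q) * ((-1) ^ (r' - j) * S (int (r' - j)) 1 (int m))))"
      by (simp add: sum_distrib_left mult_ac)
    also have "(\<Sum>j=0..r'. S (int j) 1 (int q) * ((-1) ^ (r' - j) * S (int (r' - j)) 1 (int m)))
        = (\<Sum>j=0..r'. (-1) ^ r' * ((-1) ^ j * S (int j) 1 (int q) * S (int r - int j - 1) 1 (int m)))"
    proof (intro sum.cong refl)
      fix j assume "j \<in> {0..r'}"
      then have j: "j \<le> r'" by simp
      then have "int r - int j - 1 = int (r' - j)" using Suc by simp
      moreover have "(-1) ^ (r' - j) = ((-1) ^ r' * (-1) ^ j :: real)"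
        using j by (metis minus_one_power_iff even_diff_nat linorder_not_le power_add even_add)
      ultimately show "S (int j) 1 (int q) * ((-1) ^ (r' - j) * S (int (r' - j)) 1 (int m)) =
          (-1) ^ r' * ((-1) ^ j * S (int j) 1 (int q) * S (int r - int j - 1) 1 (int m))"
        by (simp add: mult_ac)
    qed
    also have "\<dots> = (-1) ^ r' * (\<Sum>j=0..r'. (-1) ^ j * S (int j) 1 (int q) * S (int r - int j - 1) 1 (int m))"
      by (simp add: sum_distrib_left)
    \<comment> \<open>Beyond either range the summands vanish: there are no \<open>j > q\<close> numbers in \<open>{1..q}\<close>, and \<open>r - j - 1\<close> is negative if \<open>j > r'\<close>.\<close>
    also have "(\<Sum>j=0..r'. (-1) ^ j * S (int j) 1 (int q) * S (int r - int j - 1) 1 (int m)) =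
        (\<Sum>j=0..q. (-1) ^ j * S (int j) 1 (int q) * S (int r - int j - 1) 1 (int m))"
    proof -
      have "S (int r - int j - 1) 1 (int m) = 0" if "j > r'" for j
        using that Suc by (simp add: S_def)
      moreover have "S (int j) 1 (int q) = 0" if "j > q" for j
        using that by (intro S_eq_0) auto
      ultimately show ?thesis
        by (intro sum.mono_neutral_cong) (auto simp: not_le)
    qed
    finally show ?thesis
      using Suc by (simp add: power_add mult_ac)
  qed
qed

section \<open>Derivatives of the terms with respect to the exponent\<close>

text \<open>
  The \<open>p\<close>-th \<open>u\<close>-derivative of \<open>F\<^sub>j(u, n)\<close> at \<open>u = q\<close>, given as the coefficient of the power series in
  \<open>u - q\<close>. The logarithms of \<open>n\<close> come from the factor \<open>n\<^bsup>u - q\<^esup> = e\<^bsup>(u - q) log n\<^esup>\<close>.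
\<close>
definition exponent_deriv :: "nat \<Rightarrow> nat \<Rightarrow> nat \<Rightarrow> nat \<Rightarrow> complex" where
  "exponent_deriv p q j n = fact p * fps_nth (power_deriv_fps q j n) p"

lemma em_partial_higher_deriv:
  assumes "n \<ge> 1"
  shows "(deriv ^^ p) (\<lambda>u. em_partial J u n) (of_nat q) =
    (\<Sum>k=1..<n. exponent_deriv p q 1 k)
    - (\<Sum>j\<le>J. of_real (bernoulli j / fact j) * exponent_deriv p q j n)"
proof -
  have eq: "(\<lambda>h. em_partial J (of_nat q + h) n) =
     (\<lambda>h. (\<Sum>k=1..<n. power_deriv 1 (of_nat q + h) (of_nat k))
        - (\<Sum>j\<le>J. of_real (bernoulli j / fact j) * power_deriv j (of_nat q + h) (of_nat n)))"
    by (simp add: em_partial_def em_poly_def power_deriv_1)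
  have "(\<lambda>h. em_partial J (of_nat q + h) n) has_fps_expansion
     ((\<Sum>k=1..<n. power_deriv_fps q 1 k)
        - (\<Sum>j\<le>J. fps_const (of_real (bernoulli j / fact j)) * power_deriv_fps q j n))"
    unfolding eq using assms
    by (intro has_fps_expansion_diff has_fps_expansion_sum has_fps_expansion_cmult_left
          power_deriv_has_fps_expansion) auto
  from fps_nth_fps_expansion[OF this, of p]
  have "(deriv ^^ p) (\<lambda>h. em_partial J (of_nat q + h) n) 0 = fact p *
     fps_nth ((\<Sum>k=1..<n. power_deriv_fps q 1 k)
        - (\<Sum>j\<le>J. fps_const (of_real (bernoulli j / fact j)) * power_deriv_fps q j n)) p"
    by simp
  also have "(deriv ^^ p) (\<lambda>h. em_partial J (of_nat q + h) n) 0 = (deriv ^^ p) (\<lambda>u. em_partial J u n) (of_nat q)"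
    by (subst (2) higher_deriv_shift_0) (simp add: o_def)
  finally show ?thesis
    by (simp add: exponent_deriv_def fps_sum_nth sum_distrib_left right_diff_distrib mult_ac)
qed

lemma of_nat_powr_diff_ge:
  assumes "n \<ge> 1" "j \<le> q + 1"
  shows "of_nat n powr (of_nat q + 1 - of_nat j) = complex_of_real (real n ^ (q + 1 - j))"
proof -
  have e: "of_nat q + 1 - of_nat j = (of_nat (q + 1 - j) :: complex)"
    using assms by (simp add: of_nat_diff)
  show ?thesis unfolding e using assms by (subst powr_nat') auto
qed

lemma of_nat_powr_diff_less:
  assumes "n \<ge> 1" "j \<ge> q + 1"
  shows "of_nat n powr (of_nat q + 1 - of_nat j) = complex_of_real (1 / real n ^ (j - q - 1))"
proof -
  have e: "of_nat q + 1 - of_nat j = - (of_nat (j - q - 1) :: complex)"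
    using assms by (simp add: of_nat_diff)
  show ?thesis unfolding e powr_minus using assms by (subst powr_nat') (auto simp: field_simps)
qed

lemma exponent_deriv_1:
  assumes "n \<ge> 1"
  shows "exponent_deriv p q 1 n = of_real (real n ^ q * ln (real n) ^ p)"
proof -
  have "exponent_deriv p q 1 n = complex_of_real (real n ^ q) *
      (\<Sum>r = 0..p. if r = 0 then of_real (ln (real n)) ^ p else 0)"
    unfolding exponent_deriv_def power_deriv_fps_nth
    using of_nat_powr_diff_ge[OF assms, of 1 q]
    by (intro arg_cong2[of _ _ _ _ times] sum.cong) (auto simp: antideriv_fps_def)
  then show ?thesis by simp
qed

lemma exponent_deriv_0:
  assumes "n \<ge> 1"
  shows "exponent_deriv p q 0 n = of_real (real n ^ (q + 1)
                    * (\<Sum>r = 0..p. (- 1) ^ r * fact p / fact (p - r)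
                                    * (ln (real n) ^ (p - r) / real (q + 1) ^ (r + 1))))"
  unfolding exponent_deriv_def power_deriv_fps_nth antideriv_fps_nth_0
  using of_nat_powr_diff_ge[OF assms, of 0 q] by (simp add: field_simps)

lemma half_up_eq: "half_up q = (q + 1) div 2"
proof (cases "even q")
  case True
  then obtain t where "q = 2 * t" by blast
  then show ?thesis by (simp add: half_up_def)
next
  case False
  then obtain t where q: "q = 2 * t + 1" by (blast elim: oddE)
  have "\<lceil>real q / 2\<rceil> = int t + 1"
    by (rule ceiling_unique) (auto simp: q field_simps)
  then show ?thesis by (simp add: half_up_def q)
qed

lemma exponent_deriv_c_coeff:
  assumes "n \<ge> 1" "k \<in> {1..half_up q}"
  shows "of_real (bernoulli (2 * k) / fact (2 * k)) * exponent_deriv p q (2 * k) n =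
     of_real ((\<Sum>r=0..p. c_coeff p q k r * ln (real n) ^ (p - r)) * real n ^ (q + 1 - 2 * k))"
proof -
  define m where "m = 2 * k - 1"
  have k: "2 * k = Suc m" "m \<le> q" "q - m = q + 1 - 2 * k" "int q - int m + 1 = int q - 2 * int k + 2"
    using assms(2) by (auto simp: m_def half_up_eq)
  have "fps_nth (antideriv_fps q (2 * k)) r =
      complex_of_real (fact q / fact (q + 1 - 2 * k) * S (int r) (int q - 2 * int k + 2) (int q))" for r
    unfolding k(1) antideriv_fps_nth_nonvanishing[OF k(2)] by (simp only: k(1)[symmetric] k(3,4))
  moreover have "of_nat n powr (of_nat q + 1 - of_nat (2 * k)) = complex_of_real (real n ^ (q + 1 - 2 * k))"
    using assms k by (intro of_nat_powr_diff_ge) auto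
  ultimately have "of_real (bernoulli (2 * k) / fact (2 * k)) * exponent_deriv p q (2 * k) n =
     of_real (bernoulli (2 * k) / fact (2 * k) * (real n ^ (q + 1 - 2 * k) *
       (\<Sum>r=0..p. fact p / fact (p - r) * (fact q / fact (q + 1 - 2 * k) * S (int r) (int q - 2 * int k + 2) (int q)) * ln (real n) ^ (p - r))))"
    unfolding exponent_deriv_def power_deriv_fps_nth by simp
  also have "bernoulli (2 * k) / fact (2 * k) * (real n ^ (q + 1 - 2 * k) *
       (\<Sum>r=0..p. fact p / fact (p - r) * (fact q / fact (q + 1 - 2 * k) * S (int r) (int q - 2 * int k + 2) (int q)) * ln (real n) ^ (p - r)))
     = (\<Sum>r=0..p. c_coeff p q k r * ln (real n) ^ (p - r)) * real n ^ (q + 1 - 2 * k)"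
    unfolding c_coeff_def sum_distrib_left sum_distrib_right by (intro sum.cong refl) (simp add: mult_ac)
  finally show ?thesis .
qed

lemma exponent_deriv_d_coeff:
  assumes "n \<ge> 1" "k > half_up q"
  shows "of_real (bernoulli (2 * k) / fact (2 * k)) * exponent_deriv p q (2 * k) n =
     of_real ((\<Sum>r=1..p. d_coeff p q k r * ln (real n) ^ (p - r)) / real n ^ (2 * k - q - 1))"
proof -
  define m where "m = 2 * k - q - 2"
  have k: "2 * k = Suc (q + 1 + m)" "int m = 2 * int k - int q - 2"
    using assms(2) by (auto simp: m_def half_up_eq)
  have sgn: "(-1) ^ m = ((-1) ^ q :: real)"
    using k(1) by (intro minus_one_power_iff[THEN trans]) (auto simp: minus_one_power_iff; presburger)
  have "(\<Prod>i=0..q+1. 2 * real k - real i) = (\<Prod>l<q+2. of_nat (2 * k - l))"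
    using k(1) by (intro prod.cong) (auto simp: of_nat_diff)
  also have "\<dots> = fact (2 * k) / fact m"
    using k(1) by (subst prod_falling_eq_fact_div) (auto simp: m_def)
  finally have den: "(\<Prod>i=0..q+1. 2 * real k - real i) = fact (2 * k) / fact m" .
  define D where "D r = (if r = 0 then 0 else (-1) ^ (r + q + 1) * fact q * fact m *
         (\<Sum>j=0..q. (-1) ^ j * S (int j) 1 (int q) * S (int r - int j - 1) 1 (2 * int k - int q - 2)))" for r
  have "fps_nth (antideriv_fps q (2 * k)) r = complex_of_real (D r)" for r
    unfolding k(1) antideriv_fps_nth_vanishing D_def k(2) power_add sgn by simp
  moreover have "of_nat n powr (of_nat q + 1 - of_nat (2 * k)) = complex_of_real (1 / real n ^ (2 * k - q - 1))"
    using assms k by (intro of_nat_powr_diff_less) auto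
  ultimately have "of_real (bernoulli (2 * k) / fact (2 * k)) * exponent_deriv p q (2 * k) n =
     of_real (bernoulli (2 * k) / fact (2 * k) * (1 / real n ^ (2 * k - q - 1) *
       (\<Sum>r=0..p. fact p / fact (p - r) * D r * ln (real n) ^ (p - r))))"
    unfolding exponent_deriv_def power_deriv_fps_nth by simp
  also have "(\<Sum>r=0..p. fact p / fact (p - r) * D r * ln (real n) ^ (p - r)) =
      (\<Sum>r=1..p. fact p / fact (p - r) * D r * ln (real n) ^ (p - r))"
    by (intro sum.mono_neutral_right) (auto simp: D_def)
  also have "bernoulli (2 * k) / fact (2 * k) * (1 / real n ^ (2 * k - q - 1) * \<dots>) =
      (\<Sum>r=1..p. d_coeff p q k r * ln (real n) ^ (p - r)) / real n ^ (2 * k - q - 1)"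
  proof -
    have "bernoulli (2 * k) / fact (2 * k) * (1 / y * (fact p / fact (p - r) * D r * x)) = d_coeff p q k r * x / y"
      if "r \<ge> 1" for r x and y :: real
      using that unfolding d_coeff_def den D_def by (simp add: mult_ac)
    then show ?thesis
      unfolding sum_distrib_left sum_divide_distrib by (intro sum.cong refl) simp
  qed
  finally show ?thesis .
qed

lemma bernoulli_0: "bernoulli 0 = 1"
  using bernoulli_exp_convolution[of 1] by simp

lemma bernoulli_1: "bernoulli (Suc 0) = - 1 / 2"
  using bernoulli_exp_convolution[of 2] by (simp add: numeral_2_eq_2 bernoulli_0 field_simps)

lemma sum_bernoulli_even:
  fixes f :: "nat \<Rightarrow> complex"
  assumes "N \<ge> 1"
  shows "(\<Sum>j\<le>2*N. of_real (bernoulli j / fact j) * f j) =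
     f 0 - 1 / 2 * f 1 + (\<Sum>k=1..N. of_real (bernoulli (2 * k) / fact (2 * k)) * f (2 * k))"
  using assms
proof (induction N rule: dec_induct)
  case base
  then show ?case
    by (simp add: numeral_2_eq_2 bernoulli_0 bernoulli_1)
next
  case (step N)
  have "bernoulli (Suc (2 * N)) = 0"
    using step by (intro bernoulli_odd) auto
  with step show ?case by simp
qed

text \<open>
  The omitted term for odd \<open>q\<close> is the second summand of \<open>const_term\<close>, so adding the latter completes
  the sum. For even \<open>q\<close> nothing is omitted, and that summand is 0: either \<open>q + 1\<close> is odd and greater
  than 1 and the Bernoulli number vanishes, or \<open>q = 0\<close> and \<open>S p 1 0\<close> is an empty sum as \<open>p \<ge> 1\<close>.
\<close>
lemma c_coeff_sum_omitted_term:
  assumes "p \<ge> 1"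
  shows "(\<Sum>k = 1..half_up q.
           (\<Sum>r \<in> {r \<in> {0..p}. \<not> (odd q \<and> k = half_up q \<and> r = p)}. c_coeff p q k r * x ^ (p - r)) * y ^ (q + 1 - 2 * k))
         + bernoulli (q + 1) / real (q + 1) * fact p * S p 1 q
       = (\<Sum>k = 1..half_up q. (\<Sum>r = 0..p. c_coeff p q k r * x ^ (p - r)) * y ^ (q + 1 - 2 * k))"
proof (cases "even q")
  case True
  have "bernoulli (q + 1) * S p 1 q = 0"
  proof (cases "q = 0")
    case True
    then show ?thesis using S_eq_0[of 0 1 p] assms by simp
  qed (use True in \<open>simp add: bernoulli_odd\<close>)
  then have z: "bernoulli (q + 1) / real (q + 1) * fact p * S p 1 q = 0"
    by (simp only: mult_eq_0_iff divide_eq_0_iff) auto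
  have "{r \<in> {0..p}. \<not> (odd q \<and> k = half_up q \<and> r = p)} = {0..p}" for k
    using True by auto
  then show ?thesis by (simp only: z add_0_right)
next
  case False
  define h where "h = half_up q"
  have h: "h \<ge> 1" "2 * h = q + 1"
    using False by (auto simp: h_def half_up_eq elim!: oddE)
  have ind: "(\<Sum>r \<in> {r \<in> {0..p}. \<not> (odd q \<and> k = h \<and> r = p)}. c_coeff p q k r * x ^ (p - r))
      = (\<Sum>r=0..p. c_coeff p q k r * x ^ (p - r)) - (if k = h then c_coeff p q h p else 0)" for k
  proof (cases "k = h")
    case True
    have "{r \<in> {0..p}. \<not> (odd q \<and> k = h \<and> r = p)} = {0..p} - {p}"
      using False True by auto
    then show ?thesis using True by (simp add: sum_diff1)
  next
    case neq: False
    then have "{r \<in> {0..p}. \<not> (odd q \<and> k = h \<and> r = p)} = {0..p}" by auto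
    then show ?thesis using neq by simp
  qed
  have c: "c_coeff p q h p = bernoulli (q + 1) / real (q + 1) * fact p * S p 1 q"
  proof -
    have e: "int q - 2 * int h + 2 = 1" using h by linarith
    show ?thesis
      unfolding c_coeff_def h(2) e by (simp del: of_nat_add of_nat_Suc)
  qed
  have "(\<Sum>k = 1..h. (if k = h then c_coeff p q h p else 0) * y ^ (q + 1 - 2 * k)) =
      (\<Sum>k = 1..h. if k = h then c_coeff p q h p else 0)"
    using h by (intro sum.cong) auto
  also have "\<dots> = c_coeff p q h p"
    using h by simp
  finally show ?thesis
    unfolding h_def [symmetric] ind left_diff_distrib sum_subtractf c by simp
qed

section \<open>The constant, the remainder and the asymptotic expansion\<close>

lemma of_nat_neq_minus_1: "(of_nat q :: complex) \<noteq> -1"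
  by (metis Re_complex_of_real complex_Re_of_nat one_complex.simps(1) uminus_complex.simps(1) of_nat_0_le_iff not_one_le_zero neg_0_le_iff_le)

lemma em_limit_higher_deriv:
  assumes "real q < real J - 1"
  shows "(deriv ^^ p) (em_limit J) (of_nat q) = (-1) ^ p * (deriv ^^ p) zeta (- of_nat q)"
proof -
  define D where "D = {u. Re u < real J - 1} - {-1 :: complex}"
  have D: "open D"
    unfolding D_def by (intro open_Diff open_halfspace_Re_lt closed_singleton)
  have q: "of_nat q \<in> D"
    using assms of_nat_neq_minus_1 by (simp add: D_def)
  have "eventually (\<lambda>u. em_limit J u = zeta (- 1 * u)) (nhds (of_nat q))"
    using eventually_nhds_in_open[OF D q]
    by eventually_elim (auto simp: D_def zeta_eq_em_limit[of _ J])
  then have "(deriv ^^ p) (em_limit J) (of_nat q) = (deriv ^^ p) (\<lambda>u. zeta (- 1 * u)) (of_nat q)"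
    by (intro higher_deriv_cong_ev refl)
  also have "\<dots> = (-1) ^ p * (deriv ^^ p) zeta (- 1 * of_nat q)"
  proof (rule higher_deriv_compose_linear[OF zeta_holomorphic D _ q])
    show "- 1 * w \<in> - {1}" if "w \<in> D" for w
      using that by (auto simp: D_def minus_equation_iff)
  qed auto
  finally show ?thesis by simp
qed

text \<open>
  Cauchy's inequality on the circle of radius 1/2 around \<open>q\<close>, which avoids the pole at \<open>-1\<close> for every
  \<open>q \<ge> 0\<close>. The radius costs a factor \<open>n\<^bsup>1/2\<^esup>\<close> in the rate.
\<close>
lemma remainder_higher_deriv_bound:
  assumes "real q + 1 / 2 < real J - 1"
  obtains C where "C \<ge> 0" "\<And>n. n \<ge> 1 \<Longrightarrow>
    norm ((deriv ^^ p) (\<lambda>u. em_partial J u n - em_limit J u) (of_nat q)) \<le> C * real n powr (real q + 3 / 2 - real J)"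
proof -
  define K where "K = cball (of_nat q :: complex) (1 / 2)"
  have K: "u \<noteq> -1 \<and> Re u \<le> real q + 1 / 2" if "u \<in> K" for u
  proof -
    have "\<bar>Re (of_nat q - u)\<bar> \<le> 1 / 2"
      using that abs_Re_le_cmod[of "of_nat q - u"] by (simp add: K_def dist_norm)
    then have "\<bar>real q - Re u\<bar> \<le> 1 / 2" by simp
    then have "Re u \<le> real q + 1 / 2" "Re u \<ge> - 1 / 2" by linarith+
    then show ?thesis by auto
  qed
  have "compact K" by (simp add: K_def)
  moreover have "u \<noteq> -1 \<and> Re u \<le> real J - 1" if "u \<in> K" for u
    using K[OF that] assms by auto
  ultimately obtain C where C: "C \<ge> 0" "\<And>u n. u \<in> K \<Longrightarrow> n \<ge> 1 \<Longrightarrow>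
    norm (em_partial J u n - em_limit J u) \<le> C * real n powr (Re u - real J + 1)"
    using em_limit_remainder_bound[of K J] by blast
  show thesis
  proof (rule that[of "fact p * C / (1 / 2) ^ p"])
    show "fact p * C / (1 / 2) ^ p \<ge> 0" using C by simp
    fix n :: nat assume n: "n \<ge> 1"
    define D where "D = {u. Re u < real J - 1} - {-1 :: complex}"
    have hol: "(\<lambda>u. em_partial J u n - em_limit J u) holomorphic_on D"
      unfolding D_def
      by (intro holomorphic_on_diff em_limit_holomorphic holomorphic_on_subset[OF em_partial_holomorphic[OF n]]) auto
    have sub: "K \<subseteq> D"
      using K assms by (fastforce simp: D_def)
    have "norm ((deriv ^^ p) (\<lambda>u. em_partial J u n - em_limit J u) (of_nat q))
        \<le> fact p * (C * real n powr (real q + 3 / 2 - real J)) / (1 / 2) ^ p"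
    proof (rule Cauchy_inequality)
      show "(\<lambda>u. em_partial J u n - em_limit J u) holomorphic_on ball (of_nat q) (1 / 2)"
        using hol sub ball_subset_cball holomorphic_on_subset unfolding K_def by blast
      show "continuous_on (cball (of_nat q) (1 / 2)) (\<lambda>u. em_partial J u n - em_limit J u)"
        using hol sub holomorphic_on_subset holomorphic_on_imp_continuous_on unfolding K_def by blast
      fix u :: complex assume "norm (of_nat q - u) = 1 / 2"
      then have u: "u \<in> K" by (simp add: K_def dist_norm)
      have "norm (em_partial J u n - em_limit J u) \<le> C * real n powr (Re u - real J + 1)"
        using C(2)[OF u n] .
      also have "\<dots> \<le> C * real n powr (real q + 3 / 2 - real J)"
        using C(1) K[OF u] n by (intro mult_left_mono powr_mono) auto
      finally show "norm (em_partial J u n - em_limit J u) \<le> C * real n powr (real q + 3 / 2 - real J)" .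
    qed simp
    then show "norm ((deriv ^^ p) (\<lambda>u. em_partial J u n - em_limit J u) (of_nat q))
        \<le> fact p * C / (1 / 2) ^ p * real n powr (real q + 3 / 2 - real J)"
      by (simp add: mult_ac)
  qed
qed

theorem lemma5p3:
  fixes p q m :: nat
  assumes "p \<ge> 1" and "m \<ge> max 1 (half_up q)"
  shows "(\<lambda>n::nat.
            complex_of_real (\<Sum>k = 1..n. real k ^ q * ln (real k) ^ p)
            - (complex_of_real
                 (real n ^ (q + 1)
                    * (\<Sum>r = 0..p. (- 1) ^ r * fact p / fact (p - r)
                                    * (ln (real n) ^ (p - r) / real (q + 1) ^ (r + 1)))
                  + 1 / 2 * real n ^ q * ln (real n) ^ p
                  + (\<Sum>k = 1..half_up q.
                       (\<Sum>r \<in> {r \<in> {0..p}. \<not> (odd q \<and> k = half_up q \<and> r = p)}.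
                          c_coeff p q k r * ln (real n) ^ (p - r))
                       * real n ^ (q + 1 - 2 * k)))
               + const_term p q
               + complex_of_real
                   (\<Sum>k = half_up q + 1..m.
                      (\<Sum>r = 1..p. d_coeff p q k r * ln (real n) ^ (p - r))
                      / real n ^ (2 * k - q - 1))))
         \<in> O(\<lambda>n. complex_of_real (ln (real n) ^ (p - 1) / real n ^ (2 * m - q)))"
    (is "?E \<in> O(?g)")
proof -
  define N where "N = m + 2"
  define J where "J = 2 * N"
  define h where "h = half_up q"
  have h: "h \<le> m" "q \<le> 2 * m"
    using assms(2) by (auto simp: h_def half_up_eq)
  define d where "d k n = (\<Sum>r = 1..p. d_coeff p q k r * ln (real n) ^ (p - r)) / real n ^ (2 * k - q - 1)" for k n
  define R where "R n = (deriv ^^ p) (\<lambda>u. em_partial J u n - em_limit J u) (of_nat q)" for n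
  \<comment> \<open>The expansion up to \<open>k = N\<close> is exact with remainder \<open>R\<close>; only the terms with \<open>k \<le> m\<close> occur in the theorem.\<close>
  have E: "?E n = R n + of_real (\<Sum>k = m+1..N. d k n)" if n: "n \<ge> 1" for n
  proof -
    define P where "P j = exponent_deriv p q j n" for j
    define b where "b k = complex_of_real (bernoulli (2 * k) / fact (2 * k)) * P (2 * k)" for k
    define A where "A = real n ^ (q + 1) * (\<Sum>r = 0..p. (- 1) ^ r * fact p / fact (p - r)
                                    * (ln (real n) ^ (p - r) / real (q + 1) ^ (r + 1)))"
    define F where "F = real n ^ q * ln (real n) ^ p"
    define Cr where "Cr = (\<Sum>k = 1..half_up q.
                       (\<Sum>r \<in> {r \<in> {0..p}. \<not> (odd q \<and> k = half_up q \<and> r = p)}.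
                          c_coeff p q k r * ln (real n) ^ (p - r))
                       * real n ^ (q + 1 - 2 * k))"
    define Cf where "Cf = (\<Sum>k = 1..half_up q. (\<Sum>r = 0..p. c_coeff p q k r * ln (real n) ^ (p - r))
                       * real n ^ (q + 1 - 2 * k))"
    define s where "s = (\<Sum>k = 1..n. real k ^ q * ln (real k) ^ p)"
    define z where "z = (-1) ^ p * (deriv ^^ p) zeta (- of_nat q)"
    define e where "e = bernoulli (q + 1) / real (q + 1) * fact p * S p 1 q"
    have Cf: "Cr + e = Cf"
      unfolding Cr_def Cf_def e_def by (rule c_coeff_sum_omitted_term[OF assms(1)])
    \<comment> \<open>Splitting off the summand \<open>k = n\<close> turns the term \<open>B\<^sub>1 n\<^sup>u = -n\<^sup>u/2\<close> into \<open>+n\<^sup>u/2\<close>.\<close>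
    have s: "s = (\<Sum>k = 1..<n. real k ^ q * ln (real k) ^ p) + F"
      using n by (simp add: s_def F_def flip: atLeastLessThanSuc_atLeastAtMost)
    have split: "{1..N} = {1..h} \<union> {h+1..m} \<union> {m+1..N}"
      using h by (auto simp: N_def)
    have "(\<Sum>k=1..N. b k) = (\<Sum>k=1..h. b k) + (\<Sum>k=h+1..m. b k) + (\<Sum>k=m+1..N. b k)"
    proof -
      have "{1..h} \<inter> {h+1..m} = {}" "({1..h} \<union> {h+1..m}) \<inter> {m+1..N} = {}"
        using h by auto
      then show ?thesis
        unfolding split by (simp only: sum.union_disjoint finite_Un finite_atLeastAtMost simp_thms)
    qed
    also have "(\<Sum>k=1..h. b k) = of_real Cf"
      unfolding Cf_def of_real_sum b_def P_def h_def using n by (intro sum.cong exponent_deriv_c_coeff refl) auto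
    also have "(\<Sum>k=h+1..m. b k) = of_real (\<Sum>k=h+1..m. d k n)"
      unfolding of_real_sum b_def P_def d_def using n by (intro sum.cong exponent_deriv_d_coeff refl) (auto simp: h_def)
    also have "(\<Sum>k=m+1..N. b k) = of_real (\<Sum>k=m+1..N. d k n)"
      unfolding of_real_sum b_def P_def d_def using n h by (intro sum.cong exponent_deriv_d_coeff refl) (auto simp: h_def)
    finally have bsum: "(\<Sum>k=1..N. b k) = of_real Cf + of_real (\<Sum>k=h+1..m. d k n) + of_real (\<Sum>k=m+1..N. d k n)" .
    have "(\<Sum>j\<le>J. of_real (bernoulli j / fact j) * P j) = P 0 - 1 / 2 * P 1 + (\<Sum>k=1..N. b k)"
      unfolding J_def b_def by (rule sum_bernoulli_even) (simp add: N_def)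
    moreover have "P 0 = of_real A" "P 1 = of_real F"
      unfolding P_def A_def F_def using n by (intro exponent_deriv_0 exponent_deriv_1; simp)+
    moreover have "(\<Sum>k=1..<n. exponent_deriv p q 1 k) = of_real (s - F)"
      unfolding s by (simp add: exponent_deriv_1 del: One_nat_def)
    ultimately have partial: "(deriv ^^ p) (\<lambda>u. em_partial J u n) (of_nat q) =
        of_real (s - F) - (of_real A - 1 / 2 * of_real F + of_real Cf + of_real (\<Sum>k=h+1..m. d k n) + of_real (\<Sum>k=m+1..N. d k n))"
      unfolding em_partial_higher_deriv[OF n] P_def [symmetric] bsum by (simp add: add_ac)
    have "R n = (deriv ^^ p) (\<lambda>u. em_partial J u n) (of_nat q) - (deriv ^^ p) (em_limit J) (of_nat q)"
      unfolding R_def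
    proof (rule higher_deriv_diff)
      define D where "D = {u. Re u < real J - 1} - {-1 :: complex}"
      show "open D"
        unfolding D_def by (intro open_Diff open_halfspace_Re_lt closed_singleton)
      show "em_limit J holomorphic_on D"
        unfolding D_def by (rule em_limit_holomorphic)
      show "(\<lambda>u. em_partial J u n) holomorphic_on D"
        by (rule holomorphic_on_subset[OF em_partial_holomorphic[OF n]]) (auto simp: D_def)
      show "of_nat q \<in> D"
        using h(2) of_nat_neq_minus_1 by (auto simp: D_def J_def N_def)
    qed
    also have "(deriv ^^ p) (em_limit J) (of_nat q) = z"
      unfolding z_def using h(2) by (intro em_limit_higher_deriv) (simp add: J_def N_def)
    finally have R: "R n = of_real (s - F) - (of_real A - 1 / 2 * of_real F + of_real Cf
        + of_real (\<Sum>k=h+1..m. d k n) + of_real (\<Sum>k=m+1..N. d k n)) - z"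
      unfolding partial .
    have "?E n = of_real s - (of_real (A + 1 / 2 * F + Cr) + (z + of_real e) + of_real (\<Sum>k=h+1..m. d k n))"
      unfolding s_def A_def F_def Cr_def z_def e_def d_def h_def const_term_def by (simp only: mult.assoc)
    also have "\<dots> = R n + of_real (\<Sum>k=m+1..N. d k n)"
      unfolding R Cf [symmetric] by (simp add: field_simps)
    finally show ?thesis .
  qed
  obtain C where C: "C \<ge> 0" "\<And>n. n \<ge> 1 \<Longrightarrow> norm (R n) \<le> C * real n powr (real q + 3 / 2 - real J)"
    unfolding R_def using remainder_higher_deriv_bound[of q J p] h(2) by (auto simp: J_def N_def)
  define D where "D = (\<Sum>k = m+1..N. \<Sum>r = 1..p. \<bar>d_coeff p q k r\<bar>)"
  show ?thesis
  proof (rule bigoI)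
    show "\<forall>\<^sub>F n in sequentially. norm (?E n) \<le> (C + D) * norm (?g n)"
      using eventually_ge_at_top[of 3]
    proof eventually_elim
      case (elim n)
      define L where "L = ln (real n)"
      \<comment> \<open>As \<open>e \<le> 3 \<le> n\<close>, the logarithm is at least 1, so its powers are monotone in the exponent.\<close>
      have "exp 1 \<le> real n" using elim exp_le by linarith
      then have L: "L \<ge> 1" unfolding L_def using elim by (subst ln_ge_iff) auto
      define g where "g = L ^ (p - 1) / real n ^ (2 * m - q)"
      have g0: "g \<ge> 0" using L by (simp add: g_def)
      have "real n powr (real q + 3 / 2 - real J) \<le> real n powr (- real (2 * m - q))"
        using elim h(2) by (intro powr_mono) (auto simp: J_def N_def of_nat_diff)
      also have "\<dots> = 1 / real n ^ (2 * m - q)"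
        using elim by (simp add: powr_minus powr_realpow divide_inverse)
      also have "\<dots> \<le> g"
        unfolding g_def using L by (intro divide_right_mono one_le_power) auto
      finally have R: "norm (R n) \<le> C * g"
        using C(2)[of n] elim C(1) by (meson mult_left_mono order_trans one_le_numeral)
      have d: "\<bar>d k n\<bar> \<le> (\<Sum>r = 1..p. \<bar>d_coeff p q k r\<bar>) * g" if k: "k \<in> {m+1..N}" for k
      proof -
        have "\<bar>d k n\<bar> = \<bar>\<Sum>r = 1..p. d_coeff p q k r * L ^ (p - r)\<bar> / real n ^ (2 * k - q - 1)"
          by (simp add: d_def L_def abs_divide)
        also have "\<dots> \<le> (\<Sum>r = 1..p. \<bar>d_coeff p q k r\<bar> * L ^ (p - 1)) / real n ^ (2 * m - q)"
        proof (intro frac_le)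
          show "\<bar>\<Sum>r = 1..p. d_coeff p q k r * L ^ (p - r)\<bar> \<le> (\<Sum>r = 1..p. \<bar>d_coeff p q k r\<bar> * L ^ (p - 1))"
          proof (rule order_trans[OF sum_abs], rule sum_mono)
            fix r assume "r \<in> {1..p}"
            then have "L ^ (p - r) \<le> L ^ (p - 1)"
              using L by (intro power_increasing) auto
            then show "\<bar>d_coeff p q k r * L ^ (p - r)\<bar> \<le> \<bar>d_coeff p q k r\<bar> * L ^ (p - 1)"
              using L by (simp add: abs_mult mult_left_mono)
          qed
          show "real n ^ (2 * m - q) \<le> real n ^ (2 * k - q - 1)"
            using elim k by (intro power_increasing) auto
        qed (use elim L in \<open>auto intro!: sum_nonneg\<close>)
        also have "\<dots> = (\<Sum>r = 1..p. \<bar>d_coeff p q k r\<bar>) * g"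
          by (simp add: g_def sum_distrib_right sum_divide_distrib)
        finally show ?thesis .
      qed
      have "norm (?E n) \<le> norm (R n) + norm (complex_of_real (\<Sum>k = m+1..N. d k n))"
        using E[of n] elim norm_triangle_ineq by simp
      also have "norm (complex_of_real (\<Sum>k = m+1..N. d k n)) \<le> (\<Sum>k = m+1..N. \<bar>d k n\<bar>)"
        unfolding norm_of_real by (rule sum_abs)
      also have "\<dots> \<le> (\<Sum>k = m+1..N. (\<Sum>r = 1..p. \<bar>d_coeff p q k r\<bar>) * g)"
        by (intro sum_mono d)
      also have "\<dots> = D * g"
        by (simp only: D_def sum_distrib_right)
      finally have "norm (?E n) \<le> (C + D) * g"
        using R by (simp add: distrib_right)
      also have "g = norm (?g n)"
        unfolding norm_of_real L_def [symmetric] g_def [symmetric] using g0 by simp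
      finally show ?case .
    qed
  qed
qed

end
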